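(* Let $d\ge 2$ be an integer, $p=d-1$, $\lambda>0$ and $u>0$, and let $\mathbf N\sim\mathrm{NDFHL}^{(d)}(\lambda,u)$ with differential entropy $h(\mathbf N)$. For $P>0$ let $$C(P)=\sup_{P_{\mathbf X}:\ \mathbb E\|\mathbf X\|^2\le P} I(\mathbf X;\mathbf X+\mathbf N),$$ the supremum being over distributions of $\mathbf X\in\mathbb R^p$ independent of $\mathbf N$. Then, as $P\to\infty$, $$C(P)=\frac p2\log P+c^*+o(1),\qquad c^*=\frac p2\log\!\left(\frac{2\pi e}{p}\right)-h(\mathbf N).$$
   Context: For an integer $d\ge2$, $p=d-1$, $\lambda>0$, $u>0$, the distribution $\mathrm{NDFHL}^{(d)}(\lambda,u)$ is the probability law on $\mathbb R^{p}$ with density $$f_{\mathbf N}(\mathbf n)=\frac{\lambda}{2^{\frac d2-1}\pi^{\frac d2}}\left(\frac{u}{\rho(\mathbf n)}\right)^{\frac d2}e^{\lambda u}K_{\frac d2}\bigl(u\rho(\mathbf n)\bigr),\qquad \rho(\mathbf n)=\sqrt{\|\mathbf n\|^2+\lambda^2},$$ where $K_\nu$ is the modified Bessel function of the second kind. Equivalently, it is the law of $\sigma\sqrt{T}\,\mathbf Z$ where $\sigma>0$, $\mathbf Z\sim\mathcal N(\mathbf 0,\mathbf I_p)$ is independent of $T$, and $T$ is inverse Gaussian with mean $\lambda/(u\sigma^2)$ and shape parameter $\lambda^2/\sigma^2$. All logarithms are natural. *)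

theory Defs
  imports "HOL-Probability.Probability"
begin

text \<open>Modified Bessel function of the second kind, via its standard integral
  representation (valid for x > 0):  K_nu(x) = int_0^infty exp(-x cosh t) cosh(nu t) dt.\<close>
definition besselK :: "real \<Rightarrow> real \<Rightarrow> real" where
  "besselK nu x = (LBINT t:{0..}. exp (- x * cosh t) * cosh (nu * t))"

definition ndfhl_density :: "real \<Rightarrow> real \<Rightarrow> real ^ 'p \<Rightarrow> real" where
  "ndfhl_density lam u n =
    (let d = real CARD('p) + 1; rho = sqrt (norm n ^ 2 + lam ^ 2) in
     lam / (2 powr (d / 2 - 1) * pi powr (d / 2)) * (u / rho) powr (d / 2)
       * exp (lam * u) * besselK (d / 2) (u * rho))"

definition ndfhl :: "real \<Rightarrow> real \<Rightarrow> (real ^ 'p) measure" where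
  "ndfhl lam u = density lborel (\<lambda>n. ennreal (ndfhl_density lam u n))"

definition ndfhl_entropy :: "real \<Rightarrow> real \<Rightarrow> 'p::finite itself \<Rightarrow> real" where
  "ndfhl_entropy lam u _ = prob_space.entropy (ndfhl lam u :: (real ^ 'p) measure) (exp 1) lborel id"

definition ndfhl_mi :: "real \<Rightarrow> real \<Rightarrow> (real ^ 'p) measure \<Rightarrow> real" where
  "ndfhl_mi lam u mu =
     prob_space.mutual_information (mu \<Otimes>\<^sub>M ndfhl lam u) (exp 1) borel borel
       fst (\<lambda>z. fst z + snd z)"

definition ndfhl_capacity :: "real \<Rightarrow> real \<Rightarrow> 'p::finite itself \<Rightarrow> real \<Rightarrow> real" where
  "ndfhl_capacity lam u _ P = Sup {ndfhl_mi lam u (mu :: (real ^ 'p) measure) | mu.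
       prob_space mu \<and> sets mu = sets borel \<and>
       integrable mu (\<lambda>x. norm x ^ 2) \<and> (\<integral>x. norm x ^ 2 \<partial>mu) \<le> P}"

end

theory Submission
  imports Defs
begin

text \<open>
  Since \<open>I(X; X + N) = h(X + N) - h(N)\<close>, only the output entropy has to be bounded. By Minkowski's
  inequality the output has second moment at most \<open>(\<surd>P + b)\<^sup>2\<close>, where \<open>b\<^sup>2\<close> bounds that of the noise,
  and among laws with a given second moment the normal one has maximal entropy. Conversely, normal
  input gives the output at least the entropy of the input, because
  \<open>h(X + N) - h(X) = I(N; X + N) \<ge> 0\<close>. In dimension \<open>p\<close> the two bounds differ by
  \<open>p * ln (1 + b / \<surd>P)\<close>. All this needs of the noise is a bounded density and a finite second moment;
  NDFHL has both because it is a scale mixture of normal laws, with inverse Gaussian variance.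
\<close>

section \<open>Laws with a finite second moment\<close>

definition second_moment :: "'a::real_normed_vector measure \<Rightarrow> real" where
  "second_moment M = (\<integral>x. (norm x)\<^sup>2 \<partial>M)"

locale finite_second_moment = prob_space M for M :: "'a::euclidean_space measure" +
  assumes sets_eq_borel [measurable_cong]: "sets M = sets borel"
    and integrable_norm_squared: "integrable M (\<lambda>x. (norm x)\<^sup>2)"

lemma (in finite_second_moment) has_bochner_integral_second_moment:
  "has_bochner_integral M (\<lambda>x. (norm x)\<^sup>2) (second_moment M)"
  unfolding second_moment_def using integrable_norm_squared by (rule has_bochner_integral_integrable)

lemma ex_pos_second_moment_le_square: "\<exists>b>0. second_moment M \<le> b\<^sup>2"
proof (intro exI conjI)
  have "0 \<le> second_moment M"
    by (simp add: second_moment_def)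
  then show "0 < sqrt (second_moment M + 1)" "second_moment M \<le> (sqrt (second_moment M + 1))\<^sup>2"
    by simp_all
qed

lemma distr_pair_snd:
  assumes "prob_space M" "sigma_finite_measure N"
  shows "distr (M \<Otimes>\<^sub>M N) N snd = N"
proof -
  interpret M: prob_space M by fact
  interpret N: sigma_finite_measure N by fact
  interpret pair_sigma_finite M N ..
  have "distr (M \<Otimes>\<^sub>M N) N snd = distr (N \<Otimes>\<^sub>M M) N fst"
    by (subst distr_pair_swap) (simp add: distr_distr comp_def case_prod_beta')
  then show ?thesis
    by (simp add: M.distr_pair_fst)
qed

lemma has_bochner_integral_pair_fst:
  fixes f :: "'a \<Rightarrow> 'b::{banach, second_countable_topology}"
  assumes "prob_space N" "has_bochner_integral M f x"
  shows "has_bochner_integral (M \<Otimes>\<^sub>M N) (\<lambda>z. f (fst z)) x"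
proof -
  have [measurable]: "f \<in> borel_measurable M"
    using assms(2) by (rule borel_measurable_has_bochner_integral)
  have "has_bochner_integral (distr (M \<Otimes>\<^sub>M N) M fst) f x"
    using assms by (simp add: prob_space.distr_pair_fst)
  then show ?thesis
    by (simp add: has_bochner_integral_iff integrable_distr_eq integral_distr)
qed

lemma has_bochner_integral_pair_snd:
  fixes f :: "'a \<Rightarrow> 'b::{banach, second_countable_topology}"
  assumes "prob_space M" "sigma_finite_measure N" "has_bochner_integral N f x"
  shows "has_bochner_integral (M \<Otimes>\<^sub>M N) (\<lambda>z. f (snd z)) x"
proof -
  have [measurable]: "f \<in> borel_measurable N"
    using assms(3) by (rule borel_measurable_has_bochner_integral)
  have "has_bochner_integral (distr (M \<Otimes>\<^sub>M N) N snd) f x"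
    using assms by (simp add: distr_pair_snd)
  then show ?thesis
    by (simp add: has_bochner_integral_iff integrable_distr_eq integral_distr)
qed

lemma norm_add_squared_le:
  fixes x y :: "'a::real_normed_vector"
  assumes "0 < a" "0 < b"
  shows "(norm (x + y))\<^sup>2 \<le> (a + b) * ((norm x)\<^sup>2 / a + (norm y)\<^sup>2 / b)"
proof -
  have "(norm (x + y))\<^sup>2 \<le> (norm x + norm y)\<^sup>2"
    by (intro power_mono norm_triangle_ineq) simp
  also have "\<dots> = (a + b) * ((norm x)\<^sup>2 / a + (norm y)\<^sup>2 / b) - (b * norm x - a * norm y)\<^sup>2 / (a * b)"
    using assms by (simp add: field_simps power2_eq_square)
  also have "\<dots> \<le> (a + b) * ((norm x)\<^sup>2 / a + (norm y)\<^sup>2 / b)"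
    using assms by simp
  finally show ?thesis .
qed

context
  fixes M N :: "'a::ordered_euclidean_space measure"
  assumes M: "finite_second_moment M" and N: "finite_second_moment N"
begin

interpretation M: finite_second_moment M by (rule M)
interpretation N: finite_second_moment N by (rule N)
interpretation pair_prob_space M N ..

lemma has_bochner_integral_pair_norm_squares:
  "has_bochner_integral (M \<Otimes>\<^sub>M N) (\<lambda>z. (a + b) * ((norm (fst z))\<^sup>2 / a + (norm (snd z))\<^sup>2 / b))
    ((a + b) * (second_moment M / a + second_moment N / b))"
  by (intro has_bochner_integral_mult_right has_bochner_integral_add has_bochner_integral_divide
      has_bochner_integral_pair_fst has_bochner_integral_pair_snd
      M.has_bochner_integral_second_moment N.has_bochner_integral_second_moment
      M.prob_space_axioms N.prob_space_axioms N.sigma_finite_measure_axioms)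

lemma integrable_pair_norm_add_squared:
  "integrable (M \<Otimes>\<^sub>M N) (\<lambda>(x, y). (norm (x + y))\<^sup>2)"
proof (rule Bochner_Integration.integrable_bound)
  show "integrable (M \<Otimes>\<^sub>M N) (\<lambda>z. (1 + 1) * ((norm (fst z))\<^sup>2 / 1 + (norm (snd z))\<^sup>2 / 1))"
    by (rule integrable.intros[OF has_bochner_integral_pair_norm_squares])
  show "AE z in M \<Otimes>\<^sub>M N. norm (case z of (x, y) \<Rightarrow> (norm (x + y))\<^sup>2)
      \<le> norm ((1 + 1) * ((norm (fst z))\<^sup>2 / 1 + (norm (snd z))\<^sup>2 / 1))"
    using norm_add_squared_le[of 1 1] by (intro AE_I2) (auto simp del: div_by_1)
qed measurable

lemma finite_second_moment_convolution: "finite_second_moment (M \<star> N)"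
proof -
  have "prob_space (M \<star> N)"
    unfolding convolution_def by (rule prob_space_distr) measurable
  then show ?thesis
    using integrable_pair_norm_add_squared
    by (simp add: finite_second_moment_def finite_second_moment_axioms_def convolution_def
        integrable_distr_eq case_prod_beta')
qed

lemma second_moment_convolution_le:
  assumes "0 < a" "0 < b" "second_moment M \<le> a\<^sup>2" "second_moment N \<le> b\<^sup>2"
  shows "second_moment (M \<star> N) \<le> (a + b)\<^sup>2"
proof -
  have "second_moment (M \<star> N) = (\<integral>(x, y). (norm (x + y))\<^sup>2 \<partial>(M \<Otimes>\<^sub>M N))"
    by (simp add: second_moment_def convolution_def integral_distr case_prod_beta')
  also have "\<dots> \<le> (\<integral>z. (a + b) * ((norm (fst z))\<^sup>2 / a + (norm (snd z))\<^sup>2 / b) \<partial>(M \<Otimes>\<^sub>M N))"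
    using norm_add_squared_le[OF assms(1,2)]
    by (intro integral_mono integrable_pair_norm_add_squared
        integrable.intros[OF has_bochner_integral_pair_norm_squares]) auto
  also have "\<dots> = (a + b) * (second_moment M / a + second_moment N / b)"
    by (rule has_bochner_integral_integral_eq[OF has_bochner_integral_pair_norm_squares])
  also have "\<dots> \<le> (a + b) * (a\<^sup>2 / a + b\<^sup>2 / b)"
    using assms by (intro mult_left_mono add_mono divide_right_mono) auto
  also have "\<dots> = (a + b)\<^sup>2"
    using assms by (simp add: power2_eq_square)
  finally show ?thesis .
qed

end

section \<open>Isotropic normal densities\<close>

definition isotropic_normal_density :: "real \<Rightarrow> 'a::euclidean_space \<Rightarrow> real" where
  "isotropic_normal_density \<sigma> x = (\<Prod>b\<in>Basis. normal_density 0 \<sigma> (x \<bullet> b))"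

lemma norm_squared_eq_sum_inner_Basis:
  fixes x :: "'a::euclidean_space"
  shows "(norm x)\<^sup>2 = (\<Sum>b\<in>Basis. (x \<bullet> b)\<^sup>2)"
  unfolding power2_norm_eq_inner by (subst euclidean_inner) (simp add: power2_eq_square)

lemma isotropic_normal_density_eq:
  fixes x :: "'a::euclidean_space"
  shows "isotropic_normal_density \<sigma> x = exp (- (norm x)\<^sup>2 / (2 * \<sigma>\<^sup>2)) / sqrt (2 * pi * \<sigma>\<^sup>2) ^ DIM('a)"
proof -
  have "exp (- (norm x)\<^sup>2 / (2 * \<sigma>\<^sup>2)) = (\<Prod>b\<in>Basis. exp (- (x \<bullet> b)\<^sup>2 / (2 * \<sigma>\<^sup>2)))"
    by (simp add: norm_squared_eq_sum_inner_Basis exp_sum[symmetric] sum_divide_distrib sum_negf)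
  then show ?thesis
    by (simp add: isotropic_normal_density_def normal_density_def prod_dividef power_divide)
qed

lemma measurable_isotropic_normal_density [measurable (raw)]:
  fixes g :: "'b \<Rightarrow> 'a::euclidean_space"
  assumes [measurable]: "\<sigma> \<in> borel_measurable M" "g \<in> borel_measurable M"
  shows "(\<lambda>y. isotropic_normal_density (\<sigma> y) (g y)) \<in> borel_measurable M"
  unfolding isotropic_normal_density_eq by measurable

lemma isotropic_normal_density_nonneg [simp]: "0 \<le> isotropic_normal_density \<sigma> x"
  by (simp add: isotropic_normal_density_def prod_nonneg)

lemma isotropic_normal_density_pos: "0 < \<sigma> \<Longrightarrow> 0 < isotropic_normal_density \<sigma> x"
  by (simp add: isotropic_normal_density_def prod_pos normal_density_pos)

lemma isotropic_normal_density_le_center: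
  fixes x :: "'a::euclidean_space"
  shows "isotropic_normal_density \<sigma> x \<le> isotropic_normal_density \<sigma> (0 :: 'a)"
  by (simp add: isotropic_normal_density_eq divide_right_mono)

lemma ln_isotropic_normal_density:
  fixes x :: "'a::euclidean_space"
  assumes "0 < \<sigma>"
  shows "ln (isotropic_normal_density \<sigma> x) = - (DIM('a) / 2 * ln (2 * pi * \<sigma>\<^sup>2)) - (norm x)\<^sup>2 / (2 * \<sigma>\<^sup>2)"
  unfolding isotropic_normal_density_eq using assms
  by (subst ln_div) (simp_all add: ln_realpow ln_sqrt)

lemma nn_integral_normal_density:
  "0 < \<sigma> \<Longrightarrow> (\<integral>\<^sup>+t. ennreal (normal_density \<mu> \<sigma> t) \<partial>lborel) = 1"
  by (subst nn_integral_eq_integral) auto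

lemma nn_integral_isotropic_normal_density_coordinate:
  fixes i :: "'a::euclidean_space"
  assumes [measurable]: "h \<in> borel_measurable borel" and "0 < \<sigma>" "i \<in> Basis"
  shows "(\<integral>\<^sup>+x. ennreal (isotropic_normal_density \<sigma> x) * h (x \<bullet> i) \<partial>lborel)
    = (\<integral>\<^sup>+t. ennreal (normal_density 0 \<sigma> t) * h t \<partial>lborel)"
proof -
  define factor where
    "factor b t = ennreal (normal_density 0 \<sigma> t) * (if b = i then h t else 1)" for b t
  have [measurable]: "factor b \<in> borel_measurable borel" for b
    unfolding factor_def by measurable
  have "ennreal (isotropic_normal_density \<sigma> x) * h (x \<bullet> i) = (\<Prod>b\<in>Basis. factor b (x \<bullet> b))" for x
    using \<open>i \<in> Basis\<close>
    by (simp add: factor_def isotropic_normal_density_def prod.distrib prod_ennreal)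
  then have "(\<integral>\<^sup>+x. ennreal (isotropic_normal_density \<sigma> x) * h (x \<bullet> i) \<partial>lborel)
      = (\<Prod>b\<in>Basis. \<integral>\<^sup>+t. factor b t \<partial>lborel)"
    by (simp add: nn_integral_lborel_prod)
  also have "\<dots> = (\<Prod>b\<in>Basis. if b = i then \<integral>\<^sup>+t. ennreal (normal_density 0 \<sigma> t) * h t \<partial>lborel else 1)"
    using \<open>0 < \<sigma>\<close> by (intro prod.cong) (simp_all add: factor_def nn_integral_normal_density)
  finally show ?thesis
    using \<open>i \<in> Basis\<close> by simp
qed

lemma nn_integral_isotropic_normal_density:
  fixes \<sigma> :: real
  assumes "0 < \<sigma>"
  shows "(\<integral>\<^sup>+x. ennreal (isotropic_normal_density \<sigma> (x :: 'a::euclidean_space)) \<partial>lborel) = 1"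
  using nn_integral_isotropic_normal_density_coordinate[OF _ assms SOME_Basis, of "\<lambda>_. 1"] assms
  by (simp add: nn_integral_normal_density)

lemma nn_integral_isotropic_normal_density_norm_squared:
  fixes \<sigma> :: real
  assumes "0 < \<sigma>"
  shows "(\<integral>\<^sup>+x. ennreal (isotropic_normal_density \<sigma> (x :: 'a::euclidean_space) * (norm x)\<^sup>2) \<partial>lborel)
    = ennreal (DIM('a) * \<sigma>\<^sup>2)"
proof -
  have variance: "(\<integral>\<^sup>+t. ennreal (normal_density 0 \<sigma> t) * ennreal (t\<^sup>2) \<partial>lborel) = ennreal (\<sigma>\<^sup>2)"
    using normal_moment_even[OF assms, of 0 1]
    by (simp add: ennreal_mult[symmetric] nn_integral_eq_integral has_bochner_integral_iff)
  have expand: "ennreal (isotropic_normal_density \<sigma> x * (norm x)\<^sup>2)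
      = (\<Sum>i\<in>Basis. ennreal (isotropic_normal_density \<sigma> x) * ennreal ((x \<bullet> i)\<^sup>2))" for x :: 'a
    by (simp add: norm_squared_eq_sum_inner_Basis ennreal_mult sum_nonneg sum_ennreal[symmetric]
        sum_distrib_left)
  have "(\<integral>\<^sup>+x. ennreal (isotropic_normal_density \<sigma> (x :: 'a) * (norm x)\<^sup>2) \<partial>lborel)
      = (\<Sum>i\<in>Basis. \<integral>\<^sup>+x. ennreal (isotropic_normal_density \<sigma> (x :: 'a)) * ennreal ((x \<bullet> i)\<^sup>2) \<partial>lborel)"
    unfolding expand by (rule nn_integral_sum) measurable
  also have "\<dots> = (\<Sum>i\<in>(Basis :: 'a set). ennreal (\<sigma>\<^sup>2))"
    by (intro sum.cong refl)
      (subst nn_integral_isotropic_normal_density_coordinate[of "\<lambda>t. ennreal (t\<^sup>2)"],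
        use assms variance in auto)
  finally show ?thesis
    by (simp add: ennreal_mult ennreal_of_nat_eq_real_of_nat)
qed

section \<open>Differential entropy of bounded densities\<close>

definition normal_entropy :: "nat \<Rightarrow> real \<Rightarrow> real" where
  "normal_entropy d Q = real d / 2 * ln (2 * pi * exp 1 * Q / real d)"

lemma normal_entropy_eq_ln:
  assumes "0 < d" "0 < Q"
  shows "normal_entropy d Q = real d / 2 * ln Q + real d / 2 * ln (2 * pi * exp 1 / real d)"
  using assms by (simp add: normal_entropy_def ln_mult ln_div field_simps)

lemma normal_entropy_mult:
  assumes "0 < d" "0 < c" "0 < Q"
  shows "normal_entropy d (c * Q) = normal_entropy d Q + real d / 2 * ln c"
  using assms by (simp add: normal_entropy_eq_ln ln_mult distrib_left)

text \<open>Meaningful only for laws with a density: for any other law \<open>RN_deriv\<close> is 0, and so is the value.\<close>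

definition differential_entropy :: "'a::euclidean_space measure \<Rightarrow> real" where
  "differential_entropy M = - KL_divergence (exp 1) lborel M"

lemma differential_entropy_density:
  assumes "f \<in> borel_measurable borel" "\<And>x. 0 \<le> f x"
  shows "differential_entropy (density lborel (\<lambda>x. ennreal (f x))) = - (\<integral>x. f x * ln (f x) \<partial>lborel)"
  using assms by (simp add: differential_entropy_def lborel.KL_density log_def)

locale bounded_density =
  finite_second_moment "density lborel (\<lambda>x. ennreal (f x))" for f :: "'a::euclidean_space \<Rightarrow> real" +
  fixes B :: real
  assumes measurable_density [measurable]: "f \<in> borel_measurable borel"
    and density_nonneg [simp]: "0 \<le> f x"
    and density_le: "f x \<le> B"
begin

abbreviation law :: "'a measure" where
  "law \<equiv> density lborel (\<lambda>x. ennreal (f x))"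

lemma has_bochner_integral_density: "has_bochner_integral lborel f 1"
proof (rule has_bochner_integral_nn_integral)
  show "(\<integral>\<^sup>+x. ennreal (f x) \<partial>lborel) = ennreal 1"
    using emeasure_space_1 by (simp add: emeasure_density)
qed simp_all

end

lemma
  fixes f :: "'a::euclidean_space \<Rightarrow> real"
  assumes [measurable]: "f \<in> borel_measurable borel" and "\<And>x. 0 \<le> f x" "\<And>x. f x \<le> B"
    and "(\<integral>\<^sup>+x. ennreal (f x) \<partial>lborel) = 1"
    and "(\<integral>\<^sup>+x. ennreal (f x * (norm x)\<^sup>2) \<partial>lborel) = ennreal V" "0 \<le> V"
  shows bounded_densityI: "bounded_density f B"
    and second_moment_density: "second_moment (density lborel f) = V"
proof -
  have moment: "has_bochner_integral lborel (\<lambda>x. f x * (norm x)\<^sup>2) V"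
    using assms by (intro has_bochner_integral_nn_integral) auto
  show "bounded_density f B"
  proof (intro bounded_density.intro finite_second_moment.intro finite_second_moment_axioms.intro
      bounded_density_axioms.intro)
    show "prob_space (density lborel f)"
      using assms(4) by (intro prob_spaceI) (simp add: emeasure_density)
    show "integrable (density lborel f) (\<lambda>x. (norm x)\<^sup>2)"
      using moment assms(2) by (simp add: integrable_real_density has_bochner_integral_iff)
  qed (use assms in simp_all)
  show "second_moment (density lborel f) = V"
    using moment assms
    by (auto simp: second_moment_def integral_real_density has_bochner_integral_iff)
qed

lemma
  fixes \<sigma> :: real
  assumes "0 < \<sigma>"
  shows bounded_density_isotropic_normal:
      "bounded_density (isotropic_normal_density \<sigma> :: 'a::euclidean_space \<Rightarrow> real)
        (isotropic_normal_density \<sigma> (0 :: 'a))"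
    and second_moment_isotropic_normal:
      "second_moment (density lborel (isotropic_normal_density \<sigma> :: 'a \<Rightarrow> real)) = DIM('a) * \<sigma>\<^sup>2"
  using nn_integral_isotropic_normal_density[OF assms]
    nn_integral_isotropic_normal_density_norm_squared[OF assms]
  by (auto intro!: bounded_densityI second_moment_density isotropic_normal_density_le_center)

lemma mult_ln_le_mult_ln_self:
  fixes a b :: real
  assumes "0 \<le> a" "0 < b"
  shows "a * ln b \<le> a * ln a + (b - a)"
proof (cases "a = 0")
  case False
  then have "a * (ln b - ln a) \<le> a * (b / a - 1)"
    using assms ln_le_minus_one[of "b / a"] by (intro mult_left_mono) (auto simp: ln_div)
  also have "\<dots> = b - a"
    using False by (simp add: right_diff_distrib)
  finally show ?thesis
    by (simp add: right_diff_distrib)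
qed (use assms in simp)

context bounded_density
begin

lemma has_bochner_integral_mult_ln_isotropic_normal:
  assumes "0 < \<sigma>"
  shows "has_bochner_integral lborel (\<lambda>x. f x * ln (isotropic_normal_density \<sigma> x))
    (- (DIM('a) / 2 * ln (2 * pi * \<sigma>\<^sup>2)) - second_moment law / (2 * \<sigma>\<^sup>2))"
proof -
  have "has_bochner_integral law (\<lambda>x. ln (isotropic_normal_density \<sigma> x))
      (- (DIM('a) / 2 * ln (2 * pi * \<sigma>\<^sup>2)) - second_moment law / (2 * \<sigma>\<^sup>2))"
    unfolding ln_isotropic_normal_density[OF assms]
    using has_bochner_integral_second_moment prob_space
    by (simp add: has_bochner_integral_iff)
  then show ?thesis
    by (simp add: has_bochner_integral_iff integrable_real_density integral_real_density)
qed

text \<open>Gibbs' inequality against a normal density bounds \<open>f x * ln (f x)\<close> from below by an integrable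
  function; from above it is at most \<open>f x * ln B\<close>.\<close>

lemma integrable_mult_ln: "integrable lborel (\<lambda>x. f x * ln (f x))"
proof -
  let ?g = "isotropic_normal_density 1 :: 'a \<Rightarrow> real"
  interpret g: bounded_density ?g "?g 0"
    by (rule bounded_density_isotropic_normal) simp
  let ?lower = "\<lambda>x. f x * ln (?g x) - (?g x - f x)"
  have lower: "?lower x \<le> f x * ln (f x)" for x
    using mult_ln_le_mult_ln_self[of "f x" "?g x"]
    by (simp add: isotropic_normal_density_pos algebra_simps)
  have upper: "f x * ln (f x) \<le> f x * ln B" for x
    using density_le[of x] density_nonneg[of x]
    by (cases "f x = 0") (auto intro!: mult_left_mono simp: le_less)
  show ?thesis
  proof (rule Bochner_Integration.integrable_bound)
    show "integrable lborel (\<lambda>x. \<bar>?lower x\<bar> + \<bar>f x * ln B\<bar>)"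
      using has_bochner_integral_mult_ln_isotropic_normal[of 1] has_bochner_integral_density
        g.has_bochner_integral_density
      by (intro Bochner_Integration.integrable_add integrable_abs Bochner_Integration.integrable_diff
          integrable_mult_left) (auto intro: integrable.intros)
    show "AE x in lborel. norm (f x * ln (f x)) \<le> norm (\<bar>?lower x\<bar> + \<bar>f x * ln B\<bar>)"
      using lower upper by (intro AE_I2) (smt (verit) real_norm_def)
  qed measurable
qed

lemma differential_entropy_le_normal_cross_entropy:
  assumes "0 < \<sigma>"
  shows "differential_entropy law \<le> DIM('a) / 2 * ln (2 * pi * \<sigma>\<^sup>2) + second_moment law / (2 * \<sigma>\<^sup>2)"
proof -
  let ?g = "isotropic_normal_density \<sigma> :: 'a \<Rightarrow> real"
  interpret g: bounded_density ?g "?g 0"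
    by (rule bounded_density_isotropic_normal) fact
  let ?H = "\<integral>x. f x * ln (f x) \<partial>lborel"
  have bound: "has_bochner_integral lborel (\<lambda>x. f x * ln (f x) + (?g x - f x)) (?H + (1 - 1))"
    by (intro has_bochner_integral_add has_bochner_integral_diff g.has_bochner_integral_density
        has_bochner_integral_density has_bochner_integral_integrable integrable_mult_ln)
  have "- (DIM('a) / 2 * ln (2 * pi * \<sigma>\<^sup>2)) - second_moment law / (2 * \<sigma>\<^sup>2)
      = (\<integral>x. f x * ln (?g x) \<partial>lborel)"
    using has_bochner_integral_mult_ln_isotropic_normal[OF assms] by (simp add: has_bochner_integral_iff)
  also have "\<dots> \<le> (\<integral>x. f x * ln (f x) + (?g x - f x) \<partial>lborel)"
    using assms
    by (intro integral_mono integrable.intros[OF bound] mult_ln_le_mult_ln_self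
        isotropic_normal_density_pos integrable.intros[OF has_bochner_integral_mult_ln_isotropic_normal])
      simp_all
  also have "\<dots> = ?H"
    using bound by (simp add: has_bochner_integral_iff)
  finally show ?thesis
    by (simp add: differential_entropy_density)
qed

lemma differential_entropy_le_second_moment:
  assumes "0 < Q" "second_moment law \<le> Q"
  shows "differential_entropy law \<le> normal_entropy DIM('a) Q"
proof -
  define \<sigma> where "\<sigma> = sqrt (Q / DIM('a))"
  have \<sigma>: "0 < \<sigma>" "\<sigma>\<^sup>2 = Q / DIM('a)"
    using assms by (auto simp: \<sigma>_def)
  have "differential_entropy law \<le> DIM('a) / 2 * ln (2 * pi * \<sigma>\<^sup>2) + second_moment law / (2 * \<sigma>\<^sup>2)"
    using \<sigma>(1) by (rule differential_entropy_le_normal_cross_entropy)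
  also have "\<dots> \<le> DIM('a) / 2 * ln (2 * pi * \<sigma>\<^sup>2) + Q / (2 * \<sigma>\<^sup>2)"
    using assms by (intro add_left_mono divide_right_mono) auto
  also have "\<dots> = normal_entropy DIM('a) Q"
    using assms by (simp add: \<sigma> normal_entropy_def ln_mult ln_div field_simps)
  finally show ?thesis .
qed

end

lemma differential_entropy_isotropic_normal:
  fixes \<sigma> :: real
  assumes "0 < \<sigma>"
  shows "differential_entropy (density lborel (isotropic_normal_density \<sigma> :: 'a::euclidean_space \<Rightarrow> real))
    = normal_entropy DIM('a) (DIM('a) * \<sigma>\<^sup>2)"
proof -
  interpret bounded_density "isotropic_normal_density \<sigma> :: 'a \<Rightarrow> real"
    "isotropic_normal_density \<sigma> (0 :: 'a)"
    using assms by (rule bounded_density_isotropic_normal)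
  have "differential_entropy law = DIM('a) / 2 * ln (2 * pi * \<sigma>\<^sup>2) + DIM('a) / 2"
    using assms has_bochner_integral_mult_ln_isotropic_normal[OF assms]
    by (simp add: differential_entropy_density second_moment_isotropic_normal has_bochner_integral_iff)
  also have "\<dots> = normal_entropy DIM('a) (DIM('a) * \<sigma>\<^sup>2)"
    using assms by (simp add: normal_entropy_def ln_mult field_simps)
  finally show ?thesis .
qed

section \<open>Additive noise channels\<close>

definition additive_noise_information :: "'a::euclidean_space measure \<Rightarrow> 'a measure \<Rightarrow> real" where
  "additive_noise_information M N =
     prob_space.mutual_information (M \<Otimes>\<^sub>M N) (exp 1) borel borel fst (\<lambda>z. fst z + snd z)"

lemma nn_integral_lborel_translate:
  fixes g :: "'a::euclidean_space \<Rightarrow> ennreal"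
  assumes [measurable]: "g \<in> borel_measurable borel"
  shows "(\<integral>\<^sup>+y. g (a + y) \<partial>lborel) = (\<integral>\<^sup>+y. g y \<partial>lborel)"
  by (subst (2) lborel_distr_plus[of a, symmetric]) (simp add: nn_integral_distr)

locale additive_noise = noise: bounded_density f B
  for f :: "'a::ordered_euclidean_space \<Rightarrow> real" and B :: real

locale additive_noise_channel = additive_noise f B + input: finite_second_moment M
  for f :: "'a::ordered_euclidean_space \<Rightarrow> real" and B :: real and M :: "'a measure"
begin

sublocale joint: pair_prob_space M noise.law ..

abbreviation joint :: "('a \<times> 'a) measure" where
  "joint \<equiv> M \<Otimes>\<^sub>M noise.law"

sublocale joint: information_space joint "exp 1"
  by unfold_locales simp

definition output_density :: "'a \<Rightarrow> real" where
  "output_density y = (\<integral>x. f (y - x) \<partial>M)"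

lemma measurable_output_density [measurable]: "output_density \<in> borel_measurable borel"
  unfolding output_density_def by measurable

lemma output_density_nonneg [simp]: "0 \<le> output_density y"
  by (simp add: output_density_def)

lemma integrable_reflected_density: "integrable M (\<lambda>x. f (y - x))"
  by (rule input.integrable_const_bound[where B = B]) (simp_all add: noise.density_le)

lemma output_density_le: "output_density y \<le> B"
  using integral_mono[OF integrable_reflected_density input.integrable_const[of B] noise.density_le]
  by (simp add: output_density_def input.prob_space)

lemma distributed_input_output:
  "distributed joint (M \<Otimes>\<^sub>M lborel) (\<lambda>z. (fst z, fst z + snd z)) (\<lambda>z. ennreal (f (snd z - fst z)))"
proof -
  have "distr joint (M \<Otimes>\<^sub>M lborel) (\<lambda>z. (fst z, fst z + snd z))
      = density (M \<Otimes>\<^sub>M lborel) (\<lambda>z. ennreal (f (snd z - fst z)))" (is "?L = ?R")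
  proof (rule measure_eqI)
    fix A assume "A \<in> sets ?L"
    then have A [measurable]: "A \<in> sets (M \<Otimes>\<^sub>M lborel)"
      by simp
    have "emeasure ?L A = (\<integral>\<^sup>+z. indicator A z \<partial>?L)"
      using A by simp
    also have "\<dots> = (\<integral>\<^sup>+z. indicator A (fst z, fst z + snd z) \<partial>joint)"
      by (rule nn_integral_distr) measurable
    also have "\<dots> = (\<integral>\<^sup>+x. \<integral>\<^sup>+n. indicator A (x, x + n) \<partial>noise.law \<partial>M)"
      by (subst noise.nn_integral_fst[symmetric]) simp_all
    also have "\<dots> = (\<integral>\<^sup>+x. \<integral>\<^sup>+n. ennreal (f (x + n - x)) * indicator A (x, x + n) \<partial>lborel \<partial>M)"
      by (intro nn_integral_cong) (simp add: nn_integral_density)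
    also have "\<dots> = (\<integral>\<^sup>+x. \<integral>\<^sup>+y. ennreal (f (y - x)) * indicator A (x, y) \<partial>lborel \<partial>M)"
      by (intro nn_integral_cong nn_integral_lborel_translate) measurable
    also have "\<dots> = (\<integral>\<^sup>+z. ennreal (f (snd z - fst z)) * indicator A z \<partial>(M \<Otimes>\<^sub>M lborel))"
      by (subst lborel.nn_integral_fst[symmetric]) simp_all
    also have "\<dots> = emeasure ?R A"
      by (rule emeasure_density[symmetric]) measurable
    finally show "emeasure ?L A = emeasure ?R A" .
  qed simp
  then show ?thesis
    by (simp add: distributed_def)
qed

lemma distributed_output:
  "distributed joint lborel (\<lambda>z. fst z + snd z) (\<lambda>y. ennreal (output_density y))"
proof -
  have "distributed joint lborel (\<lambda>z. fst z + snd z)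
      (\<lambda>y. \<integral>\<^sup>+x. ennreal (f (snd (x, y) - fst (x, y))) \<partial>M)"
    by (rule joint.distr_marginal2[OF _ _ distributed_input_output]) unfold_locales
  moreover have "(\<integral>\<^sup>+x. ennreal (f (snd (x, y) - fst (x, y))) \<partial>M) = ennreal (output_density y)" for y
    unfolding output_density_def using integrable_reflected_density
    by (simp add: nn_integral_eq_integral)
  ultimately show ?thesis
    by simp
qed

lemma convolution_eq_output: "M \<star> noise.law = density lborel (\<lambda>y. ennreal (output_density y))"
  using distributed_distr_eq_density[OF distributed_output]
  by (simp add: convolution_def case_prod_beta' cong: distr_cong)

lemma bounded_density_output: "bounded_density output_density B"
  using finite_second_moment_convolution[OF input.finite_second_moment_axioms
      noise.finite_second_moment_axioms]
  unfolding convolution_eq_output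
  by (intro bounded_density.intro bounded_density_axioms.intro) (simp_all add: output_density_le)

interpretation received: bounded_density output_density B
  by (rule bounded_density_output)

lemma finite_entropy_input: "joint.finite_entropy M fst (\<lambda>_. 1)"
  by (simp add: joint.finite_entropy_def distributed_def noise.distr_pair_fst density_1)

lemma finite_entropy_output: "joint.finite_entropy lborel (\<lambda>z. fst z + snd z) output_density"
  using distributed_output received.integrable_mult_ln by (simp add: joint.finite_entropy_def log_def)

text \<open>Given the input, the output is a translate of the noise, so the joint entropy relative to
  \<open>M \<Otimes>\<^sub>M lborel\<close> is that of the noise.\<close>

lemma has_bochner_integral_input_output_ln:
  "has_bochner_integral (M \<Otimes>\<^sub>M lborel) (\<lambda>z. f (snd z - fst z) * ln (f (snd z - fst z)))
    (- differential_entropy noise.law)"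
proof -
  have "has_bochner_integral noise.law (\<lambda>n. ln (f n)) (- differential_entropy noise.law)"
    using noise.integrable_mult_ln
    by (simp add: differential_entropy_density has_bochner_integral_iff integrable_real_density
        integral_real_density)
  then have "has_bochner_integral joint (\<lambda>z. ln (f (snd z))) (- differential_entropy noise.law)"
    by (intro has_bochner_integral_pair_snd) unfold_locales
  then show ?thesis
    by (simp add: has_bochner_integral_iff distributed_integrable[OF distributed_input_output]
        distributed_integral[OF distributed_input_output])
qed

lemma finite_entropy_input_output:
  "joint.finite_entropy (M \<Otimes>\<^sub>M lborel) (\<lambda>z. (fst z, fst z + snd z)) (\<lambda>z. f (snd z - fst z))"
  using distributed_input_output has_bochner_integral_input_output_ln
  by (simp add: joint.finite_entropy_def log_def has_bochner_integral_iff)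

lemma additive_noise_information_eq_mutual_information_lborel:
  "additive_noise_information M noise.law
    = joint.mutual_information (exp 1) M lborel fst (\<lambda>z. fst z + snd z)"
  unfolding additive_noise_information_def joint.mutual_information_def
  by (intro arg_cong2[where f = "KL_divergence (exp 1)"] arg_cong2[where f = pair_measure] distr_cong
      sets_pair_measure_cong) (simp_all add: input.sets_eq_borel)

lemma additive_noise_information_nonneg: "0 \<le> additive_noise_information M noise.law"
  unfolding additive_noise_information_eq_mutual_information_lborel
  by (rule joint.mutual_information_nonneg'[OF _ _ finite_entropy_input finite_entropy_output
        finite_entropy_input_output]) unfold_locales

lemma additive_noise_information_eq:
  "additive_noise_information M noise.law
    = differential_entropy (M \<star> noise.law) - differential_entropy noise.law"
proof -
  have output_integrable: "integrable (M \<Otimes>\<^sub>M lborel)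
      (\<lambda>z. f (snd z - fst z) * log (exp 1) (output_density (snd z)))"
    using joint.finite_entropy_integrable_transform[OF finite_entropy_output distributed_input_output,
        where f = snd] by simp
  have "joint.mutual_information (exp 1) M lborel fst (\<lambda>z. fst z + snd z)
      = joint.entropy (exp 1) M fst + joint.entropy (exp 1) lborel (\<lambda>z. fst z + snd z)
        - joint.entropy (exp 1) (M \<Otimes>\<^sub>M lborel) (\<lambda>z. (fst z, fst z + snd z))"
    using joint.finite_entropy_distributed[OF finite_entropy_input] distributed_output
      distributed_input_output output_integrable
      joint.finite_entropy_integrable[OF finite_entropy_input_output]
    by (intro joint.mutual_information_eq_entropy_conditional_entropy_distr[where Px = "\<lambda>_. 1"])
      (auto intro: lborel.sigma_finite_measure_axioms input.sigma_finite_measure_axioms)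
  also have "joint.entropy (exp 1) M fst = 0"
    using joint.finite_entropy_distributed[OF finite_entropy_input]
    by (subst joint.entropy_distr[where f = "\<lambda>_. 1"]) auto
  also have "joint.entropy (exp 1) lborel (\<lambda>z. fst z + snd z) = differential_entropy (M \<star> noise.law)"
    by (simp add: joint.entropy_distr[OF distributed_output] convolution_eq_output
        differential_entropy_density log_def)
  also have "joint.entropy (exp 1) (M \<Otimes>\<^sub>M lborel) (\<lambda>z. (fst z, fst z + snd z))
      = differential_entropy noise.law"
    using has_bochner_integral_input_output_ln
    by (simp add: joint.entropy_distr[OF distributed_input_output] has_bochner_integral_iff log_def)
  finally show ?thesis
    by (simp add: additive_noise_information_eq_mutual_information_lborel)
qed

lemma differential_entropy_le_convolution:
  "differential_entropy noise.law \<le> differential_entropy (M \<star> noise.law)"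
  using additive_noise_information_nonneg additive_noise_information_eq by simp

end

section \<open>Capacity of additive noise channels\<close>

definition achievable_information :: "'a::euclidean_space measure \<Rightarrow> real \<Rightarrow> real set" where
  "achievable_information N P =
     {additive_noise_information M N | M. finite_second_moment M \<and> second_moment M \<le> P}"

definition additive_noise_capacity :: "'a::euclidean_space measure \<Rightarrow> real \<Rightarrow> real" where
  "additive_noise_capacity N P = Sup (achievable_information N P)"

context additive_noise
begin

lemma achievable_information_le:
  assumes "I \<in> achievable_information noise.law P" "0 < P" "0 < b" "second_moment noise.law \<le> b\<^sup>2"
  shows "I \<le> normal_entropy DIM('a) ((sqrt P + b)\<^sup>2) - differential_entropy noise.law"
proof -
  obtain M where I: "I = additive_noise_information M noise.law"
    and M: "finite_second_moment M" "second_moment M \<le> P"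
    using assms(1) unfolding achievable_information_def by blast
  interpret M: finite_second_moment M by fact
  interpret additive_noise_channel f B M ..
  interpret received: bounded_density output_density B by (rule bounded_density_output)
  have "second_moment received.law \<le> (sqrt P + b)\<^sup>2"
    using M assms noise.finite_second_moment_axioms
    unfolding convolution_eq_output[symmetric] by (intro second_moment_convolution_le) simp_all
  moreover have "0 < (sqrt P + b)\<^sup>2"
    using assms by (intro zero_less_power add_nonneg_pos) simp_all
  ultimately show ?thesis
    using received.differential_entropy_le_second_moment
    by (simp add: I additive_noise_information_eq convolution_eq_output)
qed

text \<open>Exchanging the roles of input and noise turns \<open>0 \<le> I(N; X + N)\<close> into a lower bound on the output
  entropy.\<close>

lemma additive_noise_information_ge:
  assumes "bounded_density g C"
  shows "differential_entropy (density lborel (\<lambda>x. ennreal (g x))) - differential_entropy noise.law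
    \<le> additive_noise_information (density lborel (\<lambda>x. ennreal (g x))) noise.law"
proof -
  interpret g: bounded_density g C by fact
  interpret additive_noise_channel f B g.law ..
  interpret swapped: additive_noise_channel g C noise.law ..
  have "(noise.law \<star> g.law) = (g.law \<star> noise.law)"
    by (rule convolution_commutative) (simp_all add: noise.finite_measure_axioms g.finite_measure_axioms)
  then show ?thesis
    using swapped.differential_entropy_le_convolution by (simp add: additive_noise_information_eq)
qed

lemma ex_achievable_information_ge:
  assumes "0 < P"
  shows "\<exists>I \<in> achievable_information noise.law P.
    normal_entropy DIM('a) P - differential_entropy noise.law \<le> I"
proof
  define \<sigma> where "\<sigma> = sqrt (P / DIM('a))"
  have \<sigma>: "0 < \<sigma>" "DIM('a) * \<sigma>\<^sup>2 = P"
    using assms by (auto simp: \<sigma>_def)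
  let ?g = "isotropic_normal_density \<sigma> :: 'a \<Rightarrow> real"
  interpret g: bounded_density ?g "?g 0"
    using \<sigma>(1) by (rule bounded_density_isotropic_normal)
  show "normal_entropy DIM('a) P - differential_entropy noise.law
      \<le> additive_noise_information g.law noise.law"
    using additive_noise_information_ge[OF g.bounded_density_axioms] \<sigma>
    by (simp add: differential_entropy_isotropic_normal)
  have "second_moment g.law = P"
    using second_moment_isotropic_normal[OF \<sigma>(1), where 'a = 'a] \<sigma>(2) by simp
  then show "additive_noise_information g.law noise.law \<in> achievable_information noise.law P"
    unfolding achievable_information_def using g.finite_second_moment_axioms by blast
qed

lemma additive_noise_capacity_le:
  assumes "0 < P" "0 < b" "second_moment noise.law \<le> b\<^sup>2"
  shows "additive_noise_capacity noise.law P
    \<le> normal_entropy DIM('a) ((sqrt P + b)\<^sup>2) - differential_entropy noise.law"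
  unfolding additive_noise_capacity_def
proof (rule cSup_least)
  show "achievable_information noise.law P \<noteq> {}"
    using ex_achievable_information_ge[OF assms(1)] by blast
qed (rule achievable_information_le[OF _ assms])

lemma additive_noise_capacity_ge:
  assumes "0 < P"
  shows "normal_entropy DIM('a) P - differential_entropy noise.law \<le> additive_noise_capacity noise.law P"
proof -
  obtain I where I: "I \<in> achievable_information noise.law P"
    "normal_entropy DIM('a) P - differential_entropy noise.law \<le> I"
    using ex_achievable_information_ge[OF assms] by blast
  obtain b where "0 < b" "second_moment noise.law \<le> b\<^sup>2"
    using ex_pos_second_moment_le_square by blast
  then have "bdd_above (achievable_information noise.law P)"
    using achievable_information_le assms by (intro bdd_aboveI)
  with I show ?thesis
    unfolding additive_noise_capacity_def by (blast intro: cSup_upper2)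
qed

theorem additive_noise_capacity_asymptotics:
  "((\<lambda>P. additive_noise_capacity noise.law P
      - (normal_entropy DIM('a) P - differential_entropy noise.law)) \<longlongrightarrow> 0) at_top"
proof -
  let ?excess = "\<lambda>P. additive_noise_capacity noise.law P
    - (normal_entropy DIM('a) P - differential_entropy noise.law)"
  obtain b where b: "0 < b" "second_moment noise.law \<le> b\<^sup>2"
    using ex_pos_second_moment_le_square by blast
  have lower: "0 \<le> ?excess P" if "0 < P" for P
    using additive_noise_capacity_ge[OF that] by simp
  have upper: "?excess P \<le> DIM('a) / 2 * ln ((1 + b / sqrt P)\<^sup>2)" if "0 < P" for P
  proof -
    have "0 < (1 + b / sqrt P)\<^sup>2"
      using that b(1) by (intro zero_less_power add_pos_pos) simp_all
    moreover have "(sqrt P + b)\<^sup>2 = (1 + b / sqrt P)\<^sup>2 * P"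
      using that by (simp add: field_simps power2_eq_square)
    ultimately have "normal_entropy DIM('a) ((sqrt P + b)\<^sup>2)
        = normal_entropy DIM('a) P + DIM('a) / 2 * ln ((1 + b / sqrt P)\<^sup>2)"
      using that by (simp only: normal_entropy_mult DIM_positive)
    then show ?thesis
      using additive_noise_capacity_le[OF that b] by linarith
  qed
  have "((\<lambda>P. b / sqrt P) \<longlongrightarrow> 0) at_top"
    by (intro tendsto_divide_0[OF tendsto_const] filterlim_at_top_imp_at_infinity sqrt_at_top)
  then have "((\<lambda>P. DIM('a) / 2 * ln ((1 + b / sqrt P)\<^sup>2)) \<longlongrightarrow> DIM('a) / 2 * ln ((1 + 0)\<^sup>2)) at_top"
    by (intro tendsto_intros) simp_all
  then have remainder: "((\<lambda>P. DIM('a) / 2 * ln ((1 + b / sqrt P)\<^sup>2)) \<longlongrightarrow> 0) at_top"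
    by simp
  show ?thesis
  proof (rule tendsto_sandwich[OF _ _ tendsto_const remainder])
    show "\<forall>\<^sub>F P in at_top. 0 \<le> ?excess P"
      using eventually_gt_at_top[of 0] by eventually_elim (rule lower)
    show "\<forall>\<^sub>F P in at_top. ?excess P \<le> DIM('a) / 2 * ln ((1 + b / sqrt P)\<^sup>2)"
      using eventually_gt_at_top[of 0] by eventually_elim (rule upper)
  qed
qed

end

section \<open>Scale mixtures of normal distributions\<close>

lemma bounded_density_normal_scale_mixture:
  fixes W :: "'s measure" and \<tau> :: "'s \<Rightarrow> real"
  assumes "prob_space W" and [measurable]: "\<tau> \<in> borel_measurable W" and \<tau>_pos: "\<And>s. 0 < \<tau> s"
    and \<tau>_squared: "integrable W (\<lambda>s. (\<tau> s)\<^sup>2)"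
    and mixture: "\<And>x. integrable W (\<lambda>s. isotropic_normal_density (\<tau> s) (x :: 'a::euclidean_space))"
  shows "bounded_density (\<lambda>x :: 'a. \<integral>s. isotropic_normal_density (\<tau> s) x \<partial>W)
    (\<integral>s. isotropic_normal_density (\<tau> s) (0 :: 'a) \<partial>W)"
proof -
  interpret W: prob_space W by fact
  interpret pair_sigma_finite W "lborel :: 'a measure" ..
  let ?f = "\<lambda>x :: 'a. \<integral>s. isotropic_normal_density (\<tau> s) x \<partial>W"
  have tonelli: "(\<integral>\<^sup>+x. ennreal (?f x) * g x \<partial>lborel)
      = (\<integral>\<^sup>+s. \<integral>\<^sup>+x. ennreal (isotropic_normal_density (\<tau> s) x) * g x \<partial>lborel \<partial>W)"
    if [measurable]: "g \<in> borel_measurable borel" for g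
  proof -
    have "ennreal (?f x) * g x = (\<integral>\<^sup>+s. ennreal (isotropic_normal_density (\<tau> s) x) * g x \<partial>W)" for x
      using mixture[of x] by (simp add: nn_integral_multc nn_integral_eq_integral)
    then show ?thesis
      by (simp add: Fubini')
  qed
  show ?thesis
  proof (rule bounded_densityI)
    show "?f \<in> borel_measurable borel"
      by measurable
    show "?f x \<le> ?f 0" for x
      by (intro integral_mono mixture isotropic_normal_density_le_center)
    show "(\<integral>\<^sup>+x. ennreal (?f x) \<partial>lborel) = 1"
      using tonelli[of "\<lambda>_. 1"] \<tau>_pos
      by (simp add: nn_integral_isotropic_normal_density W.emeasure_space_1)
    show "(\<integral>\<^sup>+x. ennreal (?f x * (norm x)\<^sup>2) \<partial>lborel) = ennreal (DIM('a) * (\<integral>s. (\<tau> s)\<^sup>2 \<partial>W))"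
      using tonelli[of "\<lambda>x. ennreal ((norm x)\<^sup>2)"] \<tau>_pos \<tau>_squared
      by (simp add: nn_integral_isotropic_normal_density_norm_squared nn_integral_eq_integral
          ennreal_mult[symmetric])
  qed simp_all
qed

section \<open>The modified Bessel function of the second kind\<close>

lemma cosh_ge_quadratic: "t\<^sup>2 / 4 \<le> cosh (t :: real)"
proof -
  have "1 + \<bar>t\<bar> + \<bar>t\<bar>\<^sup>2 / 2 \<le> exp \<bar>t\<bar>"
    by (rule exp_lower_Taylor_quadratic) simp
  moreover have "exp \<bar>t\<bar> / 2 \<le> cosh \<bar>t\<bar>"
    by (simp add: cosh_field_def)
  ultimately show ?thesis
    by simp
qed

lemma measurable_cosh_real [measurable]: "(cosh :: real \<Rightarrow> real) \<in> borel_measurable borel"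
  by (intro borel_measurable_continuous_onI continuous_intros)

lemma integrable_exp_minus_cosh:
  fixes x \<nu> :: real
  assumes "0 < x"
  shows "integrable lborel (\<lambda>t. exp (\<nu> * t - x * cosh t))"
proof (rule Bochner_Integration.integrable_bound)
  let ?gauss = "\<lambda>t. sqrt (2 * pi * (sqrt (2 / x))\<^sup>2) * exp (\<nu>\<^sup>2 / x)
      * normal_density (2 * \<nu> / x) (sqrt (2 / x)) t"
  show "integrable lborel ?gauss"
    using assms by simp
  have "exp (\<nu> * t - x * cosh t) \<le> ?gauss t" for t
  proof -
    have "x * (t\<^sup>2 / 4) \<le> x * cosh t"
      using cosh_ge_quadratic assms by (intro mult_left_mono) auto
    then have "exp (\<nu> * t - x * cosh t) \<le> exp (\<nu> * t - x * (t\<^sup>2 / 4))"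
      by simp
    also have "\<nu> * t - x * (t\<^sup>2 / 4) = \<nu>\<^sup>2 / x + - (t - 2 * \<nu> / x)\<^sup>2 / (2 * (sqrt (2 / x))\<^sup>2)"
      using assms by (simp add: field_simps power2_eq_square)
    also have "exp \<dots> = ?gauss t"
      using assms by (simp add: normal_density_def exp_add[symmetric] field_simps)
    finally show ?thesis .
  qed
  then show "AE t in lborel. norm (exp (\<nu> * t - x * cosh t)) \<le> norm (?gauss t)"
    by simp
qed measurable

lemma exp_mult_cosh_eq_average:
  fixes x \<nu> t :: real
  shows "exp (- x * cosh t) * cosh (\<nu> * t) = (exp (\<nu> * t - x * cosh t) + exp (- \<nu> * t - x * cosh t)) / 2"
  by (simp add: cosh_field_def[of "\<nu> * t"] exp_add[symmetric] distrib_left)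

lemma has_bochner_integral_cosh_besselK:
  fixes x \<nu> :: real
  assumes "0 < x"
  shows "has_bochner_integral lborel (\<lambda>t. exp (- x * cosh t) * cosh (\<nu> * t)) (2 * besselK \<nu> x)"
proof -
  have "integrable lborel (\<lambda>t. exp (- x * cosh t) * cosh (\<nu> * t))"
    unfolding exp_mult_cosh_eq_average
    by (intro integrable_divide Bochner_Integration.integrable_add integrable_exp_minus_cosh assms)
  then have "set_integrable lborel {0..} (\<lambda>t. exp (- x * cosh t) * cosh (\<nu> * t))"
    unfolding set_integrable_def by (rule integrable_mult_indicator[rotated]) simp
  then have "has_bochner_integral lborel
      (\<lambda>t. indicator {0..} t *\<^sub>R (exp (- x * cosh t) * cosh (\<nu> * t))) (besselK \<nu> x)"
    unfolding set_integrable_def besselK_def set_lebesgue_integral_def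
    by (rule has_bochner_integral_integrable)
  from has_bochner_integral_even_function[OF this] show ?thesis
    by simp
qed

lemma has_bochner_integral_besselK:
  fixes x \<nu> :: real
  assumes "0 < x"
  shows "has_bochner_integral lborel (\<lambda>t. exp (\<nu> * t - x * cosh t)) (2 * besselK \<nu> x)"
proof -
  define I where "I = (\<integral>t. exp (\<nu> * t - x * cosh t) \<partial>lborel)"
  have I: "has_bochner_integral lborel (\<lambda>t. exp (\<nu> * t - x * cosh t)) I"
    unfolding I_def using integrable_exp_minus_cosh[OF assms] by (rule has_bochner_integral_integrable)
  then have "has_bochner_integral lborel (\<lambda>t. exp (- \<nu> * t - x * cosh t)) I"
    using lborel_has_bochner_integral_real_affine_iff[of "-1" "\<lambda>t. exp (\<nu> * t - x * cosh t)" I 0] by simp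
  with I have "has_bochner_integral lborel (\<lambda>t. exp (- x * cosh t) * cosh (\<nu> * t)) ((I + I) / 2)"
    unfolding exp_mult_cosh_eq_average by (intro has_bochner_integral_divide has_bochner_integral_add)
  then have "I = 2 * besselK \<nu> x"
    using has_bochner_integral_eq[OF has_bochner_integral_cosh_besselK[OF assms]] by fastforce
  with I show ?thesis
    by simp
qed

lemma besselK_minus: "besselK (- \<nu>) x = besselK \<nu> x"
  by (simp add: besselK_def)

text \<open>Substitute \<open>t = ln (b / a) - s\<close>.\<close>

lemma has_bochner_integral_besselK_product:
  fixes a b \<nu> :: real
  assumes "0 < a" "0 < b"
  shows "has_bochner_integral lborel (\<lambda>s. exp (- (a\<^sup>2 * exp s + b\<^sup>2 * exp (- s)) / 2 - \<nu> * s))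
    (2 * (a / b) powr \<nu> * besselK \<nu> (a * b))"
proof -
  let ?kernel = "\<lambda>t. exp (\<nu> * t - a * b * cosh t)"
  have "has_bochner_integral lborel ?kernel (2 * besselK \<nu> (a * b))"
    using assms by (intro has_bochner_integral_besselK) simp
  then have "has_bochner_integral lborel (\<lambda>s. ?kernel (ln (b / a) + - 1 * s)) (2 * besselK \<nu> (a * b))"
    by (subst (asm) lborel_has_bochner_integral_real_affine_iff[of "-1" _ _ "ln (b / a)"]) simp_all
  then have "has_bochner_integral lborel (\<lambda>s. (a / b) powr \<nu> * ?kernel (ln (b / a) + - 1 * s))
      ((a / b) powr \<nu> * (2 * besselK \<nu> (a * b)))"
    by (rule has_bochner_integral_mult_right)
  moreover have "(a / b) powr \<nu> * ?kernel (ln (b / a) + - 1 * s)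
      = exp (- (a\<^sup>2 * exp s + b\<^sup>2 * exp (- s)) / 2 - \<nu> * s)" for s
  proof -
    have "a * b * cosh (ln (b / a) + - 1 * s) = (a\<^sup>2 * exp s + b\<^sup>2 * exp (- s)) / 2"
      using assms by (simp add: cosh_field_def exp_diff exp_minus field_simps power2_eq_square)
    moreover have "(a / b) powr \<nu> = exp (- \<nu> * ln (b / a))"
      using assms by (simp add: powr_def ln_div algebra_simps)
    ultimately show ?thesis
      by (simp add: exp_add[symmetric] algebra_simps)
  qed
  ultimately show ?thesis
    by (simp add: mult_ac)
qed

lemma integral_lborel_bij_substitution:
  fixes F g g' :: "real \<Rightarrow> real"
  assumes "integrable lborel F" "\<And>v. 0 \<le> F v" "bij g"
    and "\<And>t. (g has_real_derivative g' t) (at t)" "\<And>t. 0 \<le> g' t"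
    and "integrable lborel (\<lambda>t. g' t * F (g t))"
  shows "(\<integral>t. g' t * F (g t) \<partial>lborel) = (\<integral>v. F v \<partial>lborel)"
proof -
  have "F absolutely_integrable_on UNIV"
    using integrable_on_lborel[OF assms(1)] by (rule nonnegative_absolutely_integrable_1) (rule assms(2))
  then have "F absolutely_integrable_on range g \<and> integral (range g) F = (\<integral>v. F v \<partial>lborel)"
    using integral_lborel[OF assms(1)] bij_is_surj[OF assms(3)] by simp
  then have "integral UNIV (\<lambda>t. \<bar>g' t\<bar> * F (g t)) = (\<integral>v. F v \<partial>lborel)"
    using has_absolute_integral_change_of_variables_1'[of UNIV g g' F] assms(4) bij_is_inj[OF assms(3)]
    by auto
  then show ?thesis
    using integral_lborel[OF assms(6)] assms(5) by simp
qed

text \<open>Substitute \<open>v = sinh (t / 2)\<close>.\<close>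

lemma besselK_half:
  fixes x :: real
  assumes "0 < x"
  shows "besselK (1 / 2) x = sqrt (pi / (2 * x)) * exp (- x)"
proof -
  define F where
    "F v = 2 * sqrt (pi / (2 * x)) * exp (- x) * normal_density 0 (sqrt (1 / (4 * x))) v" for v
  have kernel: "cosh (t / 2) / 2 * F (sinh (t / 2)) = exp (- x * cosh t) * cosh (1 / 2 * t)" for t
  proof -
    have "F v = 2 * exp (- x * (2 * v\<^sup>2 + 1))" for v
      using assms by (simp add: F_def normal_density_def exp_diff exp_minus field_simps)
    moreover have "cosh t = 2 * (sinh (t / 2))\<^sup>2 + 1"
      using cosh_double[of "t / 2"] cosh_square_eq[of "t / 2"] by simp
    ultimately show ?thesis
      by simp
  qed
  have "2 * besselK (1 / 2) x = (\<integral>t. cosh (t / 2) / 2 * F (sinh (t / 2)) \<partial>lborel)"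
    unfolding kernel using has_bochner_integral_cosh_besselK[OF assms, of "1 / 2"]
    by (simp add: has_bochner_integral_iff)
  also have "\<dots> = (\<integral>v. F v \<partial>lborel)"
  proof (rule integral_lborel_bij_substitution)
    show "integrable lborel F"
      unfolding F_def using assms by simp
    show "0 \<le> F v" for v
      unfolding F_def using assms by (intro mult_nonneg_nonneg) simp_all
    show "bij (\<lambda>t::real. sinh (t / 2))"
      by (intro bijI surjI[where f = "\<lambda>v. 2 * arsinh v"]) (simp_all add: inj_def)
    show "((\<lambda>t. sinh (t / 2)) has_real_derivative cosh (t / 2) / 2) (at t)" for t :: real
      by (auto intro!: derivative_eq_intros)
    show "integrable lborel (\<lambda>t. cosh (t / 2) / 2 * F (sinh (t / 2)))"
      unfolding kernel using has_bochner_integral_cosh_besselK[OF assms] by (rule integrable.intros)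
  qed simp
  also have "\<dots> = 2 * sqrt (pi / (2 * x)) * exp (- x)"
    unfolding F_def using assms by simp
  finally show ?thesis
    by simp
qed

section \<open>The NDFHL law\<close>

text \<open>The density of \<open>ln T\<close> for \<open>T\<close> inverse Gaussian with mean \<open>lam / u\<close> and shape parameter \<open>lam\<^sup>2\<close>.\<close>

definition log_inverse_gaussian_density :: "real \<Rightarrow> real \<Rightarrow> real \<Rightarrow> real" where
  "log_inverse_gaussian_density lam u s =
     lam * exp (lam * u) / sqrt (2 * pi) * exp (- (u\<^sup>2 * exp s + lam\<^sup>2 * exp (- s)) / 2 - s / 2)"

lemma measurable_log_inverse_gaussian_density [measurable]:
  "log_inverse_gaussian_density lam u \<in> borel_measurable borel"
  unfolding log_inverse_gaussian_density_def by measurable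

lemma log_inverse_gaussian_density_nonneg: "0 < lam \<Longrightarrow> 0 \<le> log_inverse_gaussian_density lam u s"
  by (simp add: log_inverse_gaussian_density_def)

lemma
  fixes lam u :: real
  assumes "0 < lam" "0 < u"
  shows has_bochner_integral_log_inverse_gaussian_density:
      "has_bochner_integral lborel (log_inverse_gaussian_density lam u) 1"
    and has_bochner_integral_log_inverse_gaussian_density_exp:
      "has_bochner_integral lborel (\<lambda>s. log_inverse_gaussian_density lam u s * exp s) (lam / u)"
proof -
  let ?c = "lam * exp (lam * u) / sqrt (2 * pi)"
  have kernel: "has_bochner_integral lborel
      (\<lambda>s. ?c * exp (- (u\<^sup>2 * exp s + lam\<^sup>2 * exp (- s)) / 2 - \<nu> * s))
      (?c * (2 * (u / lam) powr \<nu> * besselK \<nu> (u * lam)))" for \<nu>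
    using assms by (intro has_bochner_integral_mult_right has_bochner_integral_besselK_product)
  have "sqrt (pi / (2 * (u * lam))) = sqrt (2 * pi) * (sqrt (lam / u) / (2 * lam))"
    using assms
    by (intro real_sqrt_unique)
      (simp_all add: power_divide power_mult_distrib, simp add: power2_eq_square)
  then have besselK: "?c * besselK (1 / 2) (u * lam) = sqrt (lam / u) / 2"
    using assms by (simp add: besselK_half exp_minus mult.commute[of u])
  have "?c * (2 * (u / lam) powr (1 / 2) * besselK (1 / 2) (u * lam))
      = 2 * sqrt (u / lam) * (sqrt (lam / u) / 2)"
    unfolding besselK[symmetric] using assms by (simp add: powr_half_sqrt)
  also have "\<dots> = 1"
    using assms by (simp add: real_sqrt_divide)
  finally have total: "?c * (2 * (u / lam) powr (1 / 2) * besselK (1 / 2) (u * lam)) = 1" .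
  show "has_bochner_integral lborel (log_inverse_gaussian_density lam u) 1"
    using kernel[of "1 / 2"] unfolding total by (simp add: log_inverse_gaussian_density_def[abs_def])
  have "?c * (2 * (u / lam) powr (- (1 / 2)) * besselK (- (1 / 2)) (u * lam))
      = 2 * sqrt (lam / u) * (sqrt (lam / u) / 2)"
    unfolding besselK[symmetric] besselK_minus using assms
    by (simp add: powr_minus powr_half_sqrt real_sqrt_divide mult_ac)
  also have "\<dots> = lam / u"
    using assms by simp
  finally have mean: "?c * (2 * (u / lam) powr (- (1 / 2)) * besselK (- (1 / 2)) (u * lam)) = lam / u" .
  show "has_bochner_integral lborel (\<lambda>s. log_inverse_gaussian_density lam u s * exp s) (lam / u)"
    using kernel[of "- (1 / 2)"] unfolding mean
    by (simp add: log_inverse_gaussian_density_def mult.assoc exp_add[symmetric] add_ac)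
qed

lemma log_inverse_gaussian_density_mult_isotropic_normal:
  fixes n :: "'a::euclidean_space"
  shows "log_inverse_gaussian_density lam u s * isotropic_normal_density (exp (s / 2)) n
    = lam * exp (lam * u) / (2 * pi) powr ((real DIM('a) + 1) / 2)
      * exp (- (u\<^sup>2 * exp s + ((norm n)\<^sup>2 + lam\<^sup>2) * exp (- s)) / 2 - (real DIM('a) + 1) / 2 * s)"
proof -
  let ?D = "DIM('a)"
  have "sqrt (2 * pi * (exp (s / 2))\<^sup>2) ^ ?D = sqrt (2 * pi) ^ ?D * exp (?D / 2 * s)"
    unfolding real_sqrt_mult real_sqrt_abs power_mult_distrib by (simp add: exp_of_nat_mult[symmetric])
  moreover have "(2 * pi) powr ((real ?D + 1) / 2) = sqrt (2 * pi) * sqrt (2 * pi) ^ ?D"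
    by (simp add: add_divide_distrib powr_add powr_half_sqrt[symmetric] powr_power mult.commute)
  moreover have "(norm n)\<^sup>2 / (2 * (exp (s / 2))\<^sup>2) = (norm n)\<^sup>2 * exp (- s) / 2"
    by (simp add: exp_minus field_simps flip: exp_double)
  ultimately show ?thesis
    by (simp add: log_inverse_gaussian_density_def isotropic_normal_density_eq exp_add[symmetric]
        exp_diff field_simps)
qed

lemma has_bochner_integral_ndfhl_density:
  fixes n :: "real ^ 'p" and lam u :: real
  assumes "0 < lam" "0 < u"
  shows "has_bochner_integral lborel
    (\<lambda>s. log_inverse_gaussian_density lam u s * isotropic_normal_density (exp (s / 2)) n)
    (ndfhl_density lam u n)"
proof -
  define \<rho> where "\<rho> = sqrt ((norm n)\<^sup>2 + lam\<^sup>2)"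
  define \<nu> where "\<nu> = (real CARD('p) + 1) / 2"
  have "0 < \<rho>" "\<rho>\<^sup>2 = (norm n)\<^sup>2 + lam\<^sup>2"
    using assms by (simp_all add: \<rho>_def add_nonneg_pos)
  have "has_bochner_integral lborel
      (\<lambda>s. lam * exp (lam * u) / (2 * pi) powr \<nu> * exp (- (u\<^sup>2 * exp s + \<rho>\<^sup>2 * exp (- s)) / 2 - \<nu> * s))
      (lam * exp (lam * u) / (2 * pi) powr \<nu> * (2 * (u / \<rho>) powr \<nu> * besselK \<nu> (u * \<rho>)))"
    using has_bochner_integral_besselK_product[OF \<open>0 < u\<close> \<open>0 < \<rho>\<close>]
    by (rule has_bochner_integral_mult_right)
  moreover have "lam * exp (lam * u) / (2 * pi) powr \<nu> * (2 * (u / \<rho>) powr \<nu> * besselK \<nu> (u * \<rho>))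
      = ndfhl_density lam u n"
    by (simp add: ndfhl_density_def Let_def \<rho>_def[symmetric] \<nu>_def[symmetric] powr_mult powr_diff)
  ultimately show ?thesis
    by (simp add: log_inverse_gaussian_density_mult_isotropic_normal \<open>\<rho>\<^sup>2 = _\<close> \<nu>_def)
qed

lemma bounded_density_ndfhl:
  fixes lam u :: real
  assumes "0 < lam" "0 < u"
  shows "bounded_density (ndfhl_density lam u :: real ^ 'p \<Rightarrow> real)
    (ndfhl_density lam u (0 :: real ^ 'p))"
proof -
  let ?W = "density lborel (log_inverse_gaussian_density lam u)"
  note nonneg = log_inverse_gaussian_density_nonneg[OF \<open>0 < lam\<close>]
  have mixture: "has_bochner_integral ?W
      (\<lambda>s. isotropic_normal_density (exp (s / 2)) n) (ndfhl_density lam u n)" for n :: "real ^ 'p"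
    using has_bochner_integral_ndfhl_density[OF assms]
    by (simp add: has_bochner_integral_iff integrable_real_density integral_real_density nonneg)
  have "prob_space ?W"
    using has_bochner_integral_log_inverse_gaussian_density[OF assms]
    by (intro prob_spaceI)
      (simp add: emeasure_density nn_integral_eq_integral has_bochner_integral_iff nonneg)
  then have "bounded_density (\<lambda>n :: real ^ 'p. \<integral>s. isotropic_normal_density (exp (s / 2)) n \<partial>?W)
      (\<integral>s. isotropic_normal_density (exp (s / 2)) (0 :: real ^ 'p) \<partial>?W)"
  proof (rule bounded_density_normal_scale_mixture)
    show "integrable ?W (\<lambda>s. (exp (s / 2))\<^sup>2)"
      using has_bochner_integral_log_inverse_gaussian_density_exp[OF assms]
      by (simp add: has_bochner_integral_iff integrable_real_density nonneg exp_double[symmetric])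
    show "integrable ?W (\<lambda>s. isotropic_normal_density (exp (s / 2)) n)" for n :: "real ^ 'p"
      using mixture by (rule integrable.intros)
  qed simp_all
  then show ?thesis
    using mixture by (simp add: has_bochner_integral_iff)
qed

lemma ndfhl_entropy_eq:
  fixes lam u :: real
  assumes "0 < lam" "0 < u"
  shows "ndfhl_entropy lam u TYPE('p::finite)
    = differential_entropy (ndfhl lam u :: (real ^ 'p) measure)"
proof -
  interpret bounded_density "ndfhl_density lam u :: real ^ 'p \<Rightarrow> real"
    "ndfhl_density lam u (0 :: real ^ 'p)"
    using assms by (rule bounded_density_ndfhl)
  have "entropy (exp 1) lborel id = differential_entropy law"
    by (simp add: entropy_def differential_entropy_def id_def distr_id2)
  then show ?thesis
    by (simp add: ndfhl_entropy_def ndfhl_def)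
qed

lemma ndfhl_capacity_eq:
  "ndfhl_capacity lam u TYPE('p::finite) P
    = additive_noise_capacity (ndfhl lam u :: (real ^ 'p) measure) P"
  by (simp add: ndfhl_capacity_def additive_noise_capacity_def achievable_information_def ndfhl_mi_def
      additive_noise_information_def finite_second_moment_def finite_second_moment_axioms_def
      second_moment_def conj_assoc)

theorem theorem2:
  fixes lam u :: real
  assumes "lam > 0" and "u > 0"
  shows "((\<lambda>P. ndfhl_capacity lam u TYPE('p::finite) P
             - (real CARD('p) / 2 * ln P
                + (real CARD('p) / 2 * ln (2 * pi * exp 1 / real CARD('p))
                   - ndfhl_entropy lam u TYPE('p))))
          \<longlongrightarrow> 0) at_top"
proof -
  interpret additive_noise "ndfhl_density lam u :: real ^ 'p \<Rightarrow> real"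
    "ndfhl_density lam u (0 :: real ^ 'p)"
    using assms by (intro additive_noise.intro bounded_density_ndfhl)
  have "((\<lambda>P. ndfhl_capacity lam u TYPE('p) P
      - (normal_entropy DIM(real ^ 'p) P - ndfhl_entropy lam u TYPE('p))) \<longlongrightarrow> 0) at_top"
    unfolding ndfhl_capacity_eq ndfhl_entropy_eq[OF assms] ndfhl_def
    by (rule additive_noise_capacity_asymptotics)
  then show ?thesis
    by (rule Lim_transform_eventually)
      (use eventually_gt_at_top[of 0] in \<open>eventually_elim, simp add: normal_entropy_eq_ln\<close>)
qed

end
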